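(* Let $\Psi=(E,\Delta)$ be an ordered simplicial complex in the class QE and let $\mathcal J$ be an order ideal of $\mathrm{Gale}(\Psi)$. Then the Gale truncation $\Psi[\mathcal J]$ is in QE. Furthermore, for every basis $B$ of $\Psi[\mathcal J]$, $IP(B,\Psi[\mathcal J])=IP(B,\Psi)$.
   Context: An ordered simplicial complex is a pair $\Psi=(E,\Delta)$ with $E$ a finite totally ordered set and $\Delta\subseteq 2^E$ a simplicial complex (closed under taking subsets, $\emptyset\in\Delta$). Elements of $\Delta$ are independent sets; inclusion-maximal ones are bases. $\Psi$ is pure if all bases have the same cardinality. The lexicographic order on subsets of $E$ is the dictionary order on increasingly sorted lists. QE: the class of $\Psi$ that are pure and such that for all bases $B_1,B_2$ and $b_1\in B_1\setminus B_2$ with $b_1>\max(B_2\setminus B_1)$, there is $b_2\in B_2\setminus B_1$ with $(B_1\setminus\{b_1\})\cup\{b_2\}\in\Delta$. For pure $\Psi$, $\mathrm{Gale}(\Psi)$ is the poset on the set of bases in which $B=\{b_1<\dots<b_d\}$ is below $B'=\{b_1'<\dots<b_d'\}$ iff $b_i\le b_i'$ for all $i$. For an order ideal (down-closed, nonempty set of bases) $\mathcal J$, the Gale truncation $\Psi[\mathcal J]$ is the ordered complex on $E$ whose bases are exactly the elements of $\mathcal J$. For a basis $B$ of an ordered complex $\Psi$, $b\in B$ is internally active if $B$ is the lexicographically smallest basis of $\Psi$ containing $B\setminus\{b\}$, and internally passive otherwise; $IP(B,\Psi)$ is the set of internally passive elements of $B$ in $\Psi$. *)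

theory Defs
  imports Main
begin

text \<open>A complex is a pair \<open>(E, \<Delta>)\<close>; the total order on the finite ground set \<open>E\<close> is
  the one induced from the linearly ordered element type.\<close>

type_synonym 'a complex = "'a set \<times> 'a set set"

definition ordered_complex :: "'a::linorder complex \<Rightarrow> bool" where
  "ordered_complex \<Psi> \<longleftrightarrow> (case \<Psi> of (E, \<Delta>) \<Rightarrow>
     finite E \<and> \<Delta> \<subseteq> Pow E \<and> {} \<in> \<Delta> \<and> (\<forall>A\<in>\<Delta>. \<forall>A'. A' \<subseteq> A \<longrightarrow> A' \<in> \<Delta>))"

definition independent_sets :: "'a complex \<Rightarrow> 'a set set" where
  "independent_sets \<Psi> = snd \<Psi>"

definition bases :: "'a complex \<Rightarrow> 'a set set" where
  "bases \<Psi> = {B \<in> independent_sets \<Psi>. \<forall>A\<in>independent_sets \<Psi>. B \<subseteq> A \<longrightarrow> A = B}"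

definition pure :: "'a complex \<Rightarrow> bool" where
  "pure \<Psi> \<longleftrightarrow> (\<forall>B\<in>bases \<Psi>. \<forall>B'\<in>bases \<Psi>. card B = card B')"

text \<open>The exchange condition never evaluates \<open>Max {}\<close>: purity and \<open>b1 \<in> B1 - B2\<close>
  force \<open>B2 - B1\<close> to be nonempty.\<close>

definition QE :: "'a::linorder complex set" where
  "QE = {\<Psi>. ordered_complex \<Psi> \<and> pure \<Psi> \<and>
     (\<forall>B1\<in>bases \<Psi>. \<forall>B2\<in>bases \<Psi>. \<forall>b1\<in>B1 - B2. b1 > Max (B2 - B1) \<longrightarrow>
        (\<exists>b2\<in>B2 - B1. (B1 - {b1}) \<union> {b2} \<in> independent_sets \<Psi>))}"

definition Gale :: "'a::linorder complex \<Rightarrow> ('a set \<times> 'a set) set" where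
  "Gale \<Psi> = {(B, B'). B \<in> bases \<Psi> \<and> B' \<in> bases \<Psi> \<and>
     list_all2 (\<le>) (sorted_list_of_set B) (sorted_list_of_set B')}"

definition Gale_ideal :: "'a::linorder complex \<Rightarrow> 'a set set \<Rightarrow> bool" where
  "Gale_ideal \<Psi> J \<longleftrightarrow> J \<subseteq> bases \<Psi> \<and> J \<noteq> {} \<and>
     (\<forall>B\<in>J. \<forall>B'. (B', B) \<in> Gale \<Psi> \<longrightarrow> B' \<in> J)"

text \<open>The complex on the same ground set generated by \<open>J\<close>. When \<open>\<Psi>\<close> is pure, \<open>J\<close> is an
  antichain, so the bases of this complex are exactly the elements of \<open>J\<close>
  (\<open>bases_Gale_truncation\<close> below).\<close>

definition Gale_truncation :: "'a complex \<Rightarrow> 'a set set \<Rightarrow> 'a complex" where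
  "Gale_truncation \<Psi> J = (fst \<Psi>, {A. \<exists>B\<in>J. A \<subseteq> B})"

definition lex_le :: "'a::linorder set \<Rightarrow> 'a set \<Rightarrow> bool" where
  "lex_le A B \<longleftrightarrow> A = B \<or>
     (sorted_list_of_set A, sorted_list_of_set B) \<in> lexord {(x, y). x < y}"

definition internally_active :: "'a::linorder complex \<Rightarrow> 'a set \<Rightarrow> 'a \<Rightarrow> bool" where
  "internally_active \<Psi> B b \<longleftrightarrow> B \<in> bases \<Psi> \<and> b \<in> B \<and>
     (\<forall>B'\<in>bases \<Psi>. B - {b} \<subseteq> B' \<longrightarrow> lex_le B B')"

definition IP :: "'a::linorder set \<Rightarrow> 'a complex \<Rightarrow> 'a set" where
  "IP B \<Psi> = {b \<in> B. \<not> internally_active \<Psi> B b}"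

lemma finite_basis:
  assumes "ordered_complex \<Psi>" "B \<in> bases \<Psi>"
  shows "finite B"
  using assms unfolding ordered_complex_def bases_def independent_sets_def
  by (cases \<Psi>) (simp, meson PowD finite_subset subsetD)

lemma partial_order_Gale:
  assumes "ordered_complex \<Psi>"
  shows "partial_order_on (bases \<Psi>) (Gale \<Psi>)"
proof -
  have "refl_on (bases \<Psi>) (Gale \<Psi>)"
    by (auto simp: refl_on_def Gale_def intro: list_all2_refl)
  moreover have "Gale \<Psi> \<subseteq> bases \<Psi> \<times> bases \<Psi>"
    by (auto simp: Gale_def)
  moreover have "trans (Gale \<Psi>)"
    by (auto simp: trans_def Gale_def intro: list_all2_trans[rotated])
  moreover have "antisym (Gale \<Psi>)"
  proof (rule antisymI)
    fix A B assume "(A, B) \<in> Gale \<Psi>" "(B, A) \<in> Gale \<Psi>"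
    then have "A \<in> bases \<Psi>" "B \<in> bases \<Psi>"
      and "sorted_list_of_set A = sorted_list_of_set B"
      by (auto simp: Gale_def intro: list_all2_antisym[rotated])
    then show "A = B"
      using finite_basis[OF assms] by (metis set_sorted_list_of_set)
  qed
  ultimately show ?thesis
    by (simp add: partial_order_on_def preorder_on_def)
qed

lemma bases_Gale_truncation:
  assumes "ordered_complex \<Psi>" "pure \<Psi>" "J \<subseteq> bases \<Psi>"
  shows "bases (Gale_truncation \<Psi> J) = J"
proof -
  have anti: "B = B'" if "B \<in> J" "B' \<in> J" "B \<subseteq> B'" for B B'
  proof (rule card_subset_eq)
    show "finite B'" using that(2) assms(3) finite_basis[OF assms(1)] by blast
    show "card B = card B'" using that(1,2) assms(2,3) unfolding pure_def by blast
  qed (rule that(3))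
  have "B \<in> J" if "B \<in> bases (Gale_truncation \<Psi> J)" for B
    using that unfolding bases_def independent_sets_def Gale_truncation_def by auto
  moreover have "B \<in> bases (Gale_truncation \<Psi> J)" if "B \<in> J" for B
  proof -
    have "A = B" if "B \<subseteq> A" "A \<subseteq> B'" "B' \<in> J" for A B'
      using anti[of B B'] that \<open>B \<in> J\<close> by blast
    then show ?thesis
      using \<open>B \<in> J\<close> unfolding bases_def independent_sets_def Gale_truncation_def by auto
  qed
  ultimately show ?thesis by blast
qed

end

theory Submission
  imports Defs
begin

text \<open>Replacing an element of a basis by a smaller one moves down in the Gale order, hence stays in
  the ideal. The exchange in QE is of this kind, and so is every basis witnessing internal
  passivity, because the Gale order refines to the lexicographic order.\<close>

text \<open>Only the entries between the two insertion points shift by one place, and sortedness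
  controls each shifted comparison.\<close>

lemma list_all2_insort:
  fixes b c :: "'a::linorder"
  assumes "sorted xs" "b \<le> c"
  shows "list_all2 (\<le>) (insort b xs) (insort c xs)"
  using assms
proof (induction xs arbitrary: b)
  case Nil
  then show ?case by simp
next
  case (Cons x xs)
  \<comment> \<open>This serves the case where \<open>b\<close> stops before \<open>x\<close> but
    \<open>c\<close> moves past it. As \<open>xs\<close> is sorted above \<open>x\<close>,
    \<open>x # xs\<close> is \<open>insort x xs\<close>, so the induction hypothesis applies with
    \<open>x\<close> in the role of \<open>b\<close>; hence \<open>b\<close> is generalized.\<close>
  have "list_all2 (\<le>) (x # xs) (insort c xs)" if "x \<le> c"
    using Cons.IH[of x] Cons.prems(1) that by (simp add: insort_is_Cons)
  then show ?case
    using Cons by (auto simp: list_all2_refl)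
qed

text \<open>At the first position where the lists differ the left entry is strictly smaller; equal
  lengths rule out a proper prefix.\<close>

lemma lexord_if_list_all2_le:
  fixes xs ys :: "'a::linorder list"
  assumes "list_all2 (\<le>) xs ys" "xs \<noteq> ys"
  shows "(xs, ys) \<in> lexord {(x, y). x < y}"
  using assms by (induction rule: list_all2_induct) auto

lemma list_all2_sorted_list_of_set_exchange:
  fixes b c :: "'a::linorder"
  assumes "finite A" "b \<notin> A" "c \<notin> A" "b \<le> c"
  shows "list_all2 (\<le>) (sorted_list_of_set (insert b A)) (sorted_list_of_set (insert c A))"
  using assms by (simp add: list_all2_insort)

lemma lex_le_exchange:
  fixes b c :: "'a::linorder"
  assumes "finite A" "b \<notin> A" "c \<notin> A" "b \<le> c"
  shows "lex_le (insert b A) (insert c A)"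
proof (cases "insert b A = insert c A")
  case False
  then have "sorted_list_of_set (insert b A) \<noteq> sorted_list_of_set (insert c A)"
    using assms(1) by (metis finite_insert set_sorted_list_of_set)
  then show ?thesis
    using lexord_if_list_all2_le[OF list_all2_sorted_list_of_set_exchange[OF assms]]
    by (simp add: lex_le_def)
qed (simp add: lex_le_def)

text \<open>By finiteness \<open>X\<close> extends to a basis, and purity leaves no room for a
  proper extension. This upgrades the independent set provided by the exchange in \<open>QE\<close>
  to a basis.\<close>

lemma basis_if_card_eq:
  assumes "ordered_complex \<Psi>" "pure \<Psi>" "B \<in> bases \<Psi>"
    and "X \<in> independent_sets \<Psi>" "card X = card B"
  shows "X \<in> bases \<Psi>"
proof -
  have "finite (independent_sets \<Psi>)"
    using assms(1) unfolding ordered_complex_def independent_sets_def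
    by (cases \<Psi>) (auto intro: finite_subset)
  then obtain C where C: "C \<in> independent_sets \<Psi>" "X \<subseteq> C"
      "\<forall>A\<in>independent_sets \<Psi>. C \<subseteq> A \<longrightarrow> C = A"
    using finite_has_maximal2 assms(4) by meson
  then have "C \<in> bases \<Psi>"
    unfolding bases_def by auto
  moreover from this have "card C = card X"
    using assms(2,3,5) unfolding pure_def by metis
  ultimately show ?thesis
    using C(2) card_subset_eq finite_basis[OF assms(1)] by metis
qed

text \<open>Both bases arise from the common set \<open>B - {b}\<close> by inserting one element, so
  comparing \<open>c\<close> with \<open>b\<close> decides the Gale comparison.\<close>

lemma Gale_ideal_exchange:
  assumes "ordered_complex \<Psi>" "Gale_ideal \<Psi> J" "B \<in> J" "b \<in> B"
    and "insert c (B - {b}) \<in> bases \<Psi>" "c \<notin> B - {b}" "c \<le> b"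
  shows "insert c (B - {b}) \<in> J"
proof -
  have B: "B \<in> bases \<Psi>"
    using assms(2,3) unfolding Gale_ideal_def by blast
  have "list_all2 (\<le>) (sorted_list_of_set (insert c (B - {b})))
      (sorted_list_of_set (insert b (B - {b})))"
    using assms(6,7) finite_basis[OF assms(1) B]
    by (intro list_all2_sorted_list_of_set_exchange) auto
  then have "(insert c (B - {b}), B) \<in> Gale \<Psi>"
    using B assms(4,5) by (simp add: Gale_def insert_absorb)
  then show ?thesis
    using assms(2,3) unfolding Gale_ideal_def by blast
qed

lemma ordered_complex_Gale_truncation:
  assumes "ordered_complex \<Psi>" "Gale_ideal \<Psi> J"
  shows "ordered_complex (Gale_truncation \<Psi> J)"
proof -
  obtain E \<Delta> where \<Psi>: "\<Psi> = (E, \<Delta>)" by fastforce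
  have J: "J \<subseteq> \<Delta>" "J \<noteq> {}"
    using assms(2) unfolding \<Psi> Gale_ideal_def bases_def independent_sets_def by auto
  have E: "finite E" "\<Delta> \<subseteq> Pow E"
    using assms(1) unfolding \<Psi> ordered_complex_def by auto
  have "{A. \<exists>B\<in>J. A \<subseteq> B} \<subseteq> Pow E"
    using J(1) E(2) by blast
  moreover have "{} \<in> {A. \<exists>B\<in>J. A \<subseteq> B}"
    using J(2) by blast
  moreover have "\<forall>A\<in>{A. \<exists>B\<in>J. A \<subseteq> B}. \<forall>A'\<subseteq>A. A' \<in> {A. \<exists>B\<in>J. A \<subseteq> B}"
    by (blast intro: subset_trans)
  ultimately show ?thesis
    using E(1) unfolding \<Psi> ordered_complex_def Gale_truncation_def fst_conv prod.case by blast
qed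

lemma QE_Gale_truncation:
  assumes "\<Psi> \<in> QE" "Gale_ideal \<Psi> J"
  shows "Gale_truncation \<Psi> J \<in> QE"
proof -
  have oc: "ordered_complex \<Psi>" and pure: "pure \<Psi>"
    using assms(1) unfolding QE_def by auto
  have J: "J \<subseteq> bases \<Psi>"
    using assms(2) unfolding Gale_ideal_def by blast
  note bases_eq = bases_Gale_truncation[OF oc pure J]
  have "\<exists>b2\<in>B2 - B1. B1 - {b1} \<union> {b2} \<in> independent_sets (Gale_truncation \<Psi> J)"
    if B: "B1 \<in> J" "B2 \<in> J" and b1: "b1 \<in> B1 - B2" "b1 > Max (B2 - B1)" for B1 B2 b1
  proof -
    have fin: "finite B1" "finite B2"
      using B J finite_basis[OF oc] by auto
    have "B1 \<in> bases \<Psi>" "B2 \<in> bases \<Psi>" using B J by auto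
    with assms(1) b1 obtain b2 where b2: "b2 \<in> B2 - B1"
        "B1 - {b1} \<union> {b2} \<in> independent_sets \<Psi>"
      unfolding QE_def by blast
    have "card (insert b2 (B1 - {b1})) = card B1"
      using fin b1(1) b2(1) by (simp add: card_Suc_Diff1 del: card_Diff_insert)
    then have "insert b2 (B1 - {b1}) \<in> bases \<Psi>"
      using basis_if_card_eq[OF oc pure \<open>B1 \<in> bases \<Psi>\<close>] b2(2) by simp
    \<comment> \<open>Here the condition on \<open>b1\<close> in \<open>QE\<close> is essential: it
      makes every candidate \<open>b2\<close> smaller than \<open>b1\<close>, so the exchange found
      in \<open>\<Psi>\<close> descends in the Gale order.\<close>
    moreover have "b2 \<le> Max (B2 - B1)"
      using fin b2(1) by (intro Max_ge) auto
    then have "b2 \<le> b1"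
      using b1(2) by order
    ultimately have "insert b2 (B1 - {b1}) \<in> J"
      using Gale_ideal_exchange[OF oc assms(2) B(1)] b1(1) b2(1) by blast
    with b2(1) show ?thesis
      unfolding Gale_truncation_def independent_sets_def snd_conv by blast
  qed
  moreover have "pure (Gale_truncation \<Psi> J)"
    using pure J unfolding pure_def bases_eq by blast
  ultimately show ?thesis
    using ordered_complex_Gale_truncation[OF oc assms(2)] unfolding QE_def mem_Collect_eq bases_eq by blast
qed

text \<open>Truncating only removes bases, so activity can only be gained. None is gained, because
  any basis of \<open>\<Psi>\<close> that refutes activity already lies in \<open>J\<close>.\<close>

lemma internally_active_Gale_truncation_iff:
  assumes "ordered_complex \<Psi>" "pure \<Psi>" "Gale_ideal \<Psi> J" "B \<in> J"
  shows "internally_active (Gale_truncation \<Psi> J) B b \<longleftrightarrow> internally_active \<Psi> B b"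
proof -
  have J: "J \<subseteq> bases \<Psi>"
    using assms(3) unfolding Gale_ideal_def by blast
  have "B' \<in> J"
    if b: "b \<in> B" and B': "B' \<in> bases \<Psi>" "B - {b} \<subseteq> B'" "\<not> lex_le B B'" for B'
  proof -
    have B: "B \<in> bases \<Psi>" using J assms(4) by blast
    have fin: "finite B" "finite B'" using finite_basis[OF assms(1)] B B'(1) by auto
    have "card B' = card B" using assms(2) B B'(1) unfolding pure_def by blast
    \<comment> \<open>By purity \<open>B'\<close> has exactly one element \<open>c\<close> outside
      \<open>B - {b}\<close>, so it is \<open>B\<close> with \<open>b\<close> replaced by
      \<open>c\<close>.\<close>
    then have "card (B' - (B - {b})) = 1"
      using fin B'(2) b card_Suc_Diff1[of B b] by (simp add: card_Diff_subset)
    then obtain c where c: "B' - (B - {b}) = {c}"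
      by (auto simp: card_1_singleton_iff)
    then have c_notin: "c \<notin> B - {b}" and B'_eq: "B' = insert c (B - {b})"
      using B'(2) by auto
    have "c < b"
    proof (rule ccontr)
      assume "\<not> c < b"
      \<comment> \<open>If \<open>b \<le> c\<close>, the replacement cannot precede \<open>B\<close>
        lexicographically; this includes \<open>c = b\<close>, where \<open>B' = B\<close>.\<close>
      then have "lex_le (insert b (B - {b})) (insert c (B - {b}))"
        using fin c_notin by (intro lex_le_exchange) auto
      with B'(3) b show False by (simp add: B'_eq insert_absorb)
    qed
    then show ?thesis
      using Gale_ideal_exchange[OF assms(1,3,4) b _ c_notin] B'(1) by (simp add: B'_eq)
  qed
  then show ?thesis
    using J assms(4) unfolding internally_active_def bases_Gale_truncation[OF assms(1,2) J]
    by blast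
qed

theorem theorem4p11:
  fixes \<Psi> :: "'a::linorder complex" and J :: "'a set set"
  assumes "\<Psi> \<in> QE"
    and "Gale_ideal \<Psi> J"
  shows "Gale_truncation \<Psi> J \<in> QE \<and>
    (\<forall>B\<in>bases (Gale_truncation \<Psi> J). IP B (Gale_truncation \<Psi> J) = IP B \<Psi>)"
proof -
  have oc: "ordered_complex \<Psi>" and pure: "pure \<Psi>"
    using assms(1) unfolding QE_def by auto
  have "J \<subseteq> bases \<Psi>"
    using assms(2) unfolding Gale_ideal_def by blast
  from bases_Gale_truncation[OF oc pure this] show ?thesis
    using QE_Gale_truncation[OF assms] internally_active_Gale_truncation_iff[OF oc pure assms(2)]
    by (simp add: IP_def)
qed

end
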